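(* Let $A$ be a tournament matrix of order $n$. If $\sigma_3(A)\ge 1/72$, then $\sigma_4(A)\ge g(\sigma_3(A))$.
   Context: A tournament matrix of order $n$ is a real $n\times n$ matrix $A$ with non-negative entries such that $A+A^T=\mathbb{J}$, where $\mathbb{J}$ is the $n\times n$ matrix with all entries equal to $1$ (in particular every diagonal entry of $A$ equals $1/2$). For a square matrix $A$ of order $n$ and an integer $\ell\ge 1$, $\sigma_\ell(A)=\frac{1}{n^\ell}\sum_{i=1}^n\lambda_i^\ell=\frac{1}{n^\ell}\operatorname{Tr}A^\ell$, where $\lambda_1,\ldots,\lambda_n\in\mathbb{C}$ are the eigenvalues of $A$ (with multiplicity). Every tournament matrix satisfies $0\le\sigma_3(A)\le 1/8$. The function $g:[0,1/8]\to[0,1]$ is defined by $g(0)=0$ and, for $z\in(0,1]$, $$g\left(\tfrac18\left(\lfloor z^{-1}\rfloor z^3+(1-\lfloor z^{-1}\rfloor z)^3\right)\right)=\tfrac1{16}\left(\lfloor z^{-1}\rfloor z^4+(1-\lfloor z^{-1}\rfloor z)^4\right);$$ this is well defined because $z\mapsto\frac18\left(\lfloor z^{-1}\rfloor z^3+(1-\lfloor z^{-1}\rfloor z)^3\right)$ is a bijection from $(0,1]$ onto $(0,1/8]$. *)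

theory Defs
  imports Complex_Main "Jordan_Normal_Form.Schur_Decomposition"
begin

definition tournament_matrix :: "nat \<Rightarrow> real mat \<Rightarrow> bool" where
  "tournament_matrix n A \<longleftrightarrow>
     A \<in> carrier_mat n n \<and>
     (\<forall>i<n. \<forall>j<n. A $$ (i, j) \<ge> 0) \<and>
     A + transpose_mat A = mat n n (\<lambda>_. 1)"

definition mat_trace :: "'a::comm_monoid_add mat \<Rightarrow> 'a" where
  "mat_trace A = (\<Sum>i<dim_row A. A $$ (i, i))"

text \<open>The real-valued trace form is taken as the definition; the lemma \<open>sigma_eigenvalues\<close>
  below identifies it with the power sum of the complex eigenvalues.\<close>

definition sigma :: "nat \<Rightarrow> real mat \<Rightarrow> real" where
  "sigma l A = mat_trace (A ^\<^sub>m l) / real (dim_row A) ^ l"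

definition cubic_profile :: "real \<Rightarrow> real" where
  "cubic_profile z = 1/8 * (of_int \<lfloor>inverse z\<rfloor> * z ^ 3 + (1 - of_int \<lfloor>inverse z\<rfloor> * z) ^ 3)"

definition quartic_profile :: "real \<Rightarrow> real" where
  "quartic_profile z = 1/16 * (of_int \<lfloor>inverse z\<rfloor> * z ^ 4 + (1 - of_int \<lfloor>inverse z\<rfloor> * z) ^ 4)"

text \<open>Only the values on \<open>{0..1/8}\<close> are meaningful. There the description is proper and \<open>g\<close>
  satisfies its defining equation, see \<open>bij_betw_cubic_profile\<close> and \<open>g_cubic_profile\<close>.\<close>

definition g :: "real \<Rightarrow> real" where
  "g x = (if x = 0 then 0
          else quartic_profile (THE z. z \<in> {0<..1} \<and> cubic_profile z = x))"


subsection \<open>Eigenvalue form of \<open>sigma\<close>\<close>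

lemma mat_trace_comm:
  fixes A B :: "'a::comm_semiring_0 mat"
  assumes A: "A \<in> carrier_mat n n" and B: "B \<in> carrier_mat n n"
  shows "mat_trace (A * B) = mat_trace (B * A)"
proof -
  have "mat_trace (A * B) = (\<Sum>i<n. \<Sum>j<n. A $$ (i, j) * B $$ (j, i))"
    using A B by (simp add: mat_trace_def scalar_prod_def lessThan_atLeast0)
  also have "\<dots> = (\<Sum>j<n. \<Sum>i<n. A $$ (i, j) * B $$ (j, i))"
    by (rule sum.swap)
  also have "\<dots> = mat_trace (B * A)"
    using A B by (simp add: mat_trace_def scalar_prod_def lessThan_atLeast0 mult.commute)
  finally show ?thesis .
qed

lemma upper_triangular_power:
  fixes B :: "'a::comm_semiring_1 mat"
  assumes B: "B \<in> carrier_mat n n" and ut: "upper_triangular B"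
  shows "(\<forall>i<n. \<forall>j<i. (B ^\<^sub>m k) $$ (i, j) = 0) \<and> (\<forall>i<n. (B ^\<^sub>m k) $$ (i, i) = B $$ (i, i) ^ k)"
proof (induction k)
  case 0
  then show ?case using B by auto
next
  case (Suc k)
  have C: "B ^\<^sub>m k \<in> carrier_mat n n"
    using B by simp
  have entry: "(B ^\<^sub>m Suc k) $$ (i, j) = (\<Sum>m<n. (B ^\<^sub>m k) $$ (i, m) * B $$ (m, j))"
    if "i < n" "j < n" for i j
    using B C that by (simp add: scalar_prod_def lessThan_atLeast0)
  have z: "B $$ (i, j) = 0" if "i < n" "j < i" for i j
    using ut B that by (auto simp: upper_triangular_def)
  have "(B ^\<^sub>m Suc k) $$ (i, j) = 0" if ij: "i < n" "j < i" for i j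
  proof -
    have "(B ^\<^sub>m k) $$ (i, m) * B $$ (m, j) = 0" if m: "m < n" for m
      using Suc z ij m by (cases "m < i") auto
    then show ?thesis
      using ij entry[of i j] by simp
  qed
  moreover have "(B ^\<^sub>m Suc k) $$ (i, i) = B $$ (i, i) ^ Suc k" if i: "i < n" for i
  proof -
    have "(B ^\<^sub>m k) $$ (i, m) * B $$ (m, i) = (if m = i then B $$ (i, i) ^ Suc k else 0)"
      if m: "m < n" for m
      using Suc z i m by (cases m i rule: linorder_cases) (auto simp: mult.commute)
    then have "(\<Sum>m<n. (B ^\<^sub>m k) $$ (i, m) * B $$ (m, i)) =
      (\<Sum>m<n. if m = i then B $$ (i, i) ^ Suc k else 0)"
      by (intro sum.cong) auto
    then show ?thesis
      using i entry[of i i] by simp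
  qed
  ultimately show ?case by blast
qed

lemma mat_trace_power_eigenvalues:
  fixes A :: "complex mat"
  assumes A: "A \<in> carrier_mat n n"
  shows "mat_trace (A ^\<^sub>m l) = (\<Sum>e\<in>#proots (char_poly A). e ^ l)"
proof -
  obtain es where es: "char_poly A = (\<Prod>e\<leftarrow>es. [:- e, 1:])"
    using char_poly_factorized[OF A] by blast
  obtain B P Q where dec: "schur_decomposition A es = (B, P, Q)"
    by (cases "schur_decomposition A es") auto
  have wit: "similar_mat_wit A B P Q" and ut: "upper_triangular B" and dg: "diag_mat B = es"
    using schur_decomposition[OF A es dec] by auto
  note w = similar_mat_witD2[OF A wit]
  have B: "B \<in> carrier_mat n n" and P: "P \<in> carrier_mat n n" and Q: "Q \<in> carrier_mat n n"
    and QP: "Q * P = 1\<^sub>m n"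
    using w by auto
  have Bl: "B ^\<^sub>m l \<in> carrier_mat n n"
    using B by simp
  have "mat_trace (A ^\<^sub>m l) = mat_trace (P * B ^\<^sub>m l * Q)"
    using similar_mat_wit_pow_id[OF wit] by simp
  also have "\<dots> = mat_trace (Q * (P * B ^\<^sub>m l))"
    by (rule mat_trace_comm[of _ n]) (use P Q Bl in auto)
  also have "Q * (P * B ^\<^sub>m l) = B ^\<^sub>m l"
    using assoc_mult_mat[OF Q P Bl] left_mult_one_mat[OF Bl] unfolding QP by simp
  also have "mat_trace (B ^\<^sub>m l) = (\<Sum>i<n. B $$ (i, i) ^ l)"
    using upper_triangular_power[OF B ut, of l] Bl B by (simp add: mat_trace_def)
  also have "\<dots> = (\<Sum>e\<leftarrow>es. e ^ l)"
    using B unfolding dg[symmetric]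
    by (simp add: diag_mat_def comp_def interv_sum_list_conv_sum_set_nat lessThan_atLeast0)
  also have "\<dots> = (\<Sum>e\<in>#proots (char_poly A). e ^ l)"
  proof -
    have "proots (\<Prod>e\<leftarrow>es. [:- e, 1:]) = mset es"
    proof (induction es)
      case Nil
      then show ?case by simp
    next
      case (Cons e es)
      have "(\<Prod>e\<leftarrow>es. [:- e, 1:]) \<noteq> 0"
        by (auto simp: prod_list_zero_iff)
      then have "proots ([:- e, 1:] * (\<Prod>e\<leftarrow>es. [:- e, 1:])) = add_mset e (mset es)"
        using Cons by (subst proots_mult) auto
      then show ?case
        by (simp del: mult_pCons_left)
    qed
    then have "proots (char_poly A) = mset es"
      unfolding es .
    then show ?thesis
      by (simp add: sum_mset_sum_list flip: mset_map)
  qed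
  finally show ?thesis .
qed

lemma sigma_eigenvalues:
  assumes A: "A \<in> carrier_mat n n"
  shows "complex_of_real (sigma l A) =
    (\<Sum>e\<in>#proots (char_poly (map_mat complex_of_real A)). e ^ l) / of_nat n ^ l"
proof -
  have pow: "map_mat complex_of_real (A ^\<^sub>m l) = map_mat complex_of_real A ^\<^sub>m l"
    using of_real_hom.mat_hom_pow[OF A] .
  have "complex_of_real (mat_trace (A ^\<^sub>m l)) = mat_trace (map_mat complex_of_real (A ^\<^sub>m l))"
    using A by (simp add: mat_trace_def)
  also have "\<dots> = (\<Sum>e\<in>#proots (char_poly (map_mat complex_of_real A)). e ^ l)"
    unfolding pow by (rule mat_trace_power_eigenvalues[of _ n]) (use A in simp)
  finally show ?thesis
    using A by (simp add: sigma_def)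
qed


subsection \<open>Well-definedness of \<open>g\<close>\<close>

lemma cubic_piece_strict_mono:
  fixes k a b :: real
  assumes k: "k \<ge> 1" and b: "1 / (k + 1) \<le> b" and ab: "b < a" and a: "a \<le> 1 / k"
  shows "k * b ^ 3 + (1 - k * b) ^ 3 < k * a ^ 3 + (1 - k * a) ^ 3"
proof -
  define u v where "u = 1 - k * a" and "v = 1 - k * b"
  have bpos: "0 < b"
    using k b by (smt (verit) divide_pos_pos)
  have u0: "0 \<le> u"
    using a k by (simp add: u_def field_simps)
  have vb: "v \<le> b"
    using b k by (simp add: v_def field_simps)
  have uv: "u < v"
    using ab k by (simp add: u_def v_def)
  have "u ^ 2 < a ^ 2"
    using u0 uv vb ab by (intro power_strict_mono) auto
  moreover have "v ^ 2 \<le> b ^ 2"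
    using u0 uv vb by (intro power_mono) auto
  moreover have "u * v \<le> a * b"
    using u0 uv vb ab by (intro mult_mono) auto
  ultimately have "0 < (a\<^sup>2 + a * b + b\<^sup>2) - (u\<^sup>2 + u * v + v\<^sup>2)"
    by linarith
  then have "0 < k * (a - b) * ((a\<^sup>2 + a * b + b\<^sup>2) - (u\<^sup>2 + u * v + v\<^sup>2))"
    using k ab by simp
  also have "\<dots> = (k * a ^ 3 + (1 - k * a) ^ 3) - (k * b ^ 3 + (1 - k * b) ^ 3)"
    by (simp add: u_def v_def power2_eq_square power3_eq_cube algebra_simps)
  finally show ?thesis by simp
qed

lemma cubic_piece_left:
  fixes k :: real
  assumes "k \<ge> 1"
  shows "k * (1 / (k + 1)) ^ 3 + (1 - k * (1 / (k + 1))) ^ 3 = 1 / (k + 1)\<^sup>2"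
proof -
  have *: "1 - k * (1 / (k + 1)) = 1 / (k + 1)"
    using assms by (simp add: field_simps)
  show ?thesis
    unfolding * using assms by (simp add: power2_eq_square power3_eq_cube divide_simps)
qed

lemma cubic_piece_right:
  fixes k :: real
  assumes "k \<ge> 1"
  shows "k * (1 / k) ^ 3 + (1 - k * (1 / k)) ^ 3 = 1 / k\<^sup>2"
  using assms by (simp add: power2_eq_square power3_eq_cube)

lemma floor_inverse_unit:
  fixes z :: real
  assumes "z \<in> {0<..1}" and "k = of_int \<lfloor>inverse z\<rfloor>"
  shows "k \<ge> 1" "1 / (k + 1) < z" "z \<le> 1 / k"
proof -
  have "1 \<le> inverse z"
    using assms by (simp add: one_le_inverse)
  then have "1 \<le> \<lfloor>inverse z\<rfloor>"
    by (simp add: le_floor_iff)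
  then show k: "k \<ge> 1"
    using assms(2) by simp
  have "k \<le> inverse z" "inverse z < k + 1"
    using assms(2) by linarith+
  then show "1 / (k + 1) < z" "z \<le> 1 / k"
    using k assms(1) by (auto simp: field_simps)
qed

lemma cubic_profile_bounds:
  fixes z :: real
  assumes z: "z \<in> {0<..1}" and k: "k = of_int \<lfloor>inverse z\<rfloor>"
  shows "1 / (k + 1)\<^sup>2 < 8 * cubic_profile z" "8 * cubic_profile z \<le> 1 / k\<^sup>2"
proof -
  note f = floor_inverse_unit[OF z k]
  have e: "8 * cubic_profile z = k * z ^ 3 + (1 - k * z) ^ 3"
    by (simp add: cubic_profile_def k)
  show "1 / (k + 1)\<^sup>2 < 8 * cubic_profile z"
    using cubic_piece_strict_mono[of k "1 / (k + 1)" z] cubic_piece_left[of k] f e by simp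
  show "8 * cubic_profile z \<le> 1 / k\<^sup>2"
  proof (cases "z = 1 / k")
    case True
    then show ?thesis
      unfolding e using cubic_piece_right[of k] f by simp
  next
    case False
    then show ?thesis
      using cubic_piece_strict_mono[of k z "1 / k"] cubic_piece_right[of k] f e by simp
  qed
qed

lemma cubic_profile_strict_anti_floor:
  assumes z: "z \<in> {0<..1}" and w: "w \<in> {0<..1}"
    and less: "\<lfloor>inverse z\<rfloor> < \<lfloor>inverse w\<rfloor>"
  shows "cubic_profile w < cubic_profile z"
proof -
  define k m :: real where "k = of_int \<lfloor>inverse z\<rfloor>" and "m = of_int \<lfloor>inverse w\<rfloor>"
  have km: "k + 1 \<le> m"
    using less unfolding k_def m_def by linarith
  have k1: "k \<ge> 1"
    by (rule floor_inverse_unit(1)[OF z k_def])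
  have "(k + 1)\<^sup>2 \<le> m\<^sup>2"
    using km k1 by (intro power_mono) auto
  then have "1 / m\<^sup>2 \<le> 1 / (k + 1)\<^sup>2"
    using k1 km by (intro divide_left_mono mult_pos_pos) auto
  then show ?thesis
    using cubic_profile_bounds(1)[OF z k_def] cubic_profile_bounds(2)[OF w m_def] by linarith
qed

lemma inj_on_cubic_profile: "inj_on cubic_profile {0<..1}"
proof (rule inj_onI)
  fix z w :: real
  assume z: "z \<in> {0<..1}" and w: "w \<in> {0<..1}" and eq: "cubic_profile z = cubic_profile w"
  have fl: "\<lfloor>inverse z\<rfloor> = \<lfloor>inverse w\<rfloor>"
    using cubic_profile_strict_anti_floor[OF z w] cubic_profile_strict_anti_floor[OF w z] eq
    by (metis less_irrefl linorder_neqE)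
  define k :: real where "k = of_int \<lfloor>inverse z\<rfloor>"
  have kw: "k = of_int \<lfloor>inverse w\<rfloor>"
    using fl k_def by simp
  note fz = floor_inverse_unit[OF z k_def] and fw = floor_inverse_unit[OF w kw]
  have e: "k * z ^ 3 + (1 - k * z) ^ 3 = k * w ^ 3 + (1 - k * w) ^ 3"
    using eq unfolding cubic_profile_def fl kw by simp
  show "z = w"
  proof (cases z w rule: linorder_cases)
    case less
    then show ?thesis
      using cubic_piece_strict_mono[of k z w] fz fw e by simp
  next
    case greater
    then show ?thesis
      using cubic_piece_strict_mono[of k w z] fz fw e by simp
  qed
qed

lemma cubic_profile_surj:
  assumes y: "y \<in> {0<..1/8::real}"
  shows "\<exists>z\<in>{0<..1}. cubic_profile z = y"
proof -
  define s where "s = sqrt (8 * y)"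
  have s: "s \<in> {0<..1}" and s2: "s\<^sup>2 = 8 * y"
    using y by (auto simp: s_def)
  define k :: real where "k = of_int \<lfloor>inverse s\<rfloor>"
  note f = floor_inverse_unit[OF s k_def]
  define p where "p = (\<lambda>z. k * z ^ 3 + (1 - k * z) ^ 3)"
  have pl: "p (1 / (k + 1)) = (1 / (k + 1))\<^sup>2" and pr: "p (1 / k) = (1 / k)\<^sup>2"
    unfolding p_def using cubic_piece_left[OF f(1)] cubic_piece_right[OF f(1)]
    by (simp_all add: power_one_over)
  have lo: "p (1 / (k + 1)) < 8 * y"
    unfolding pl s2[symmetric] using f by (intro power_strict_mono) auto
  have hi: "8 * y \<le> p (1 / k)"
    unfolding pr s2[symmetric] using f s by (intro power_mono) auto
  have "\<exists>z\<ge>1 / (k + 1). z \<le> 1 / k \<and> p z = 8 * y"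
  proof (rule IVT')
    show "1 / (k + 1) \<le> 1 / k"
      using f(1) by (simp add: field_simps)
    show "continuous_on {1 / (k + 1)..1 / k} p"
      unfolding p_def by (intro continuous_intros)
  qed (use lo hi in auto)
  then obtain z where z: "1 / (k + 1) \<le> z" "z \<le> 1 / k" "p z = 8 * y"
    by blast
  have zlt: "1 / (k + 1) < z"
    using z lo by (cases "z = 1 / (k + 1)") auto
  have z0: "0 < z"
    using zlt f(1) by (smt (verit) divide_pos_pos)
  have "1 / k \<le> 1"
    using f(1) by simp
  then have z1: "z \<in> {0<..1}"
    using z z0 by auto
  have "k \<le> inverse z" "inverse z < k + 1"
    using z(2) zlt z0 f(1) by (auto simp: field_simps)
  then have "\<lfloor>inverse z\<rfloor> = \<lfloor>inverse s\<rfloor>"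
    unfolding k_def by linarith
  then have "cubic_profile z = 1/8 * p z"
    by (simp add: cubic_profile_def p_def k_def)
  then show ?thesis
    using z(3) z1 by auto
qed

lemma bij_betw_cubic_profile: "bij_betw cubic_profile {0<..1} {0<..1/8}"
proof (rule bij_betw_imageI[OF inj_on_cubic_profile], intro equalityI subsetI)
  fix y assume "y \<in> cubic_profile ` {0<..1}"
  then obtain z where z: "z \<in> {0<..1}" and y: "y = cubic_profile z"
    by blast
  define k :: real where "k = of_int \<lfloor>inverse z\<rfloor>"
  have k: "k \<ge> 1"
    by (rule floor_inverse_unit(1)[OF z k_def])
  have "0 < 1 / (k + 1)\<^sup>2" "1 / k\<^sup>2 \<le> 1"
    using k by auto
  then show "y \<in> {0<..1/8}"
    using cubic_profile_bounds[OF z k_def] y unfolding greaterThanAtMost_iff by linarith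
next
  fix y :: real assume "y \<in> {0<..1/8}"
  then show "y \<in> cubic_profile ` {0<..1}"
    using cubic_profile_surj by blast
qed

lemma g_0: "g 0 = 0"
  by (simp add: g_def)

lemma g_cubic_profile:
  assumes z: "z \<in> {0<..1}"
  shows "g (cubic_profile z) = quartic_profile z"
proof -
  have "cubic_profile z \<in> {0<..1/8}"
    using bij_betw_apply[OF bij_betw_cubic_profile z] .
  moreover have "(THE w. w \<in> {0<..1} \<and> cubic_profile w = cubic_profile z) = z"
    using z inj_on_cubic_profile by (intro the_equality) (auto dest: inj_onD)
  ultimately show ?thesis
    by (simp add: g_def)
qed

end

theory Submission
  imports Defs
begin

text \<open>
  Rescale the eigenvalues of \<open>A\<close> to \<open>\<mu> = 2 \<lambda> / n\<close>. They sum to 1 and have non-negative real parts,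
  because \<open>A + A\<^sup>T\<close> is positive semidefinite. Put \<open>G t = 16 * g (t / 8)\<close>.

  If all \<open>\<mu>\<close> are real, merge the two smallest of them while at least four remain. A merge does not
  lower the cubic sum \<open>t\<close> and raises the quartic sum by at most 3/5 of the increase of \<open>t\<close>, whereas \<open>G\<close>
  has slope at least 3/5 on \<open>[1/9, 1]\<close>. For three numbers with sum 1 and second elementary symmetric
  function \<open>q\<close> the quartic sum is \<open>2 q\<^sup>2 + (4 t - 1) / 3\<close>, and minimising \<open>q\<close> for fixed \<open>t\<close> gives \<open>G t\<close>.

  In general replace every \<open>\<mu>\<close> by its real part. If \<open>\<kappa>\<close> is at least twice the real part of every
  non-real \<open>\<mu>\<close>, this does not increase \<open>\<Sum> Re (\<mu>\<^sup>4) - \<kappa> \<Sum> Re (\<mu>\<^sup>3)\<close>, so it remains to choose \<open>\<kappa>\<close> no larger than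
  the relevant slope of \<open>G\<close>. Here 3/5 works unless some non-real \<open>\<mu>\<close> has real part \<open>a > 3/10\<close>.
  In that case \<open>\<mu>\<close>, its conjugate and the Perron eigenvalue (which is at least \<open>a\<close>) force \<open>a \<le> 1/3\<close>, hence the
  cubic sum of the real parts is at most \<open>2 a\<^sup>3 + (1 - 2 a)\<^sup>3\<close>, which is close to 1/9; there the slope
  of \<open>G\<close> is at least \<open>2 a\<close>.
\<close>

subsection \<open>The slope of the extremal function\<close>

definition scaled_g :: "real \<Rightarrow> real" where
  "scaled_g t = 16 * g (t / 8)"

lemma scaled_g_low:
  fixes z :: real
  assumes "1/3 \<le> z" "z \<le> 1/2"
  shows "scaled_g (2 * z ^ 3 + (1 - 2 * z) ^ 3) = 2 * z ^ 4 + (1 - 2 * z) ^ 4"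
proof (cases "z = 1/3")
  case True
  \<comment> \<open>Here the floor is 3 instead of 2, but both formulas describe the triple 1/3,
    1/3, 1/3.\<close>
  have "g (cubic_profile (1/3)) = quartic_profile (1/3)"
    by (rule g_cubic_profile) auto
  then show ?thesis
    by (simp add: True scaled_g_def cubic_profile_def quartic_profile_def power3_eq_cube power4_eq_xxxx)
next
  case False
  have "\<lfloor>inverse z\<rfloor> = 2"
    using assms False by (intro floor_unique) (auto simp: field_simps)
  moreover have "g (cubic_profile z) = quartic_profile z"
    using assms by (intro g_cubic_profile) auto
  ultimately show ?thesis
    by (simp add: scaled_g_def cubic_profile_def quartic_profile_def)
qed

text \<open>For t > 1/4 the floor is 1 and the extremal pair is z, 1 - z. Writing z = (1 + s) / 2
  turns both sums into polynomials in s^2, which eliminates z. At t = 1/4 the pair 1/2, 1/2 belongs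
  to the other branch.\<close>

lemma scaled_g_high:
  fixes t :: real
  assumes "1/4 \<le> t" "t \<le> 1"
  shows "scaled_g t = 2 * (1 - t)\<^sup>2 / 9 + (4 * t - 1) / 3"
proof (cases "t = 1/4")
  case True
  then show ?thesis
    using scaled_g_low[of "1/2"] unfolding True by (simp add: power3_eq_cube power4_eq_xxxx power2_eq_square)
next
  case False
  define s where "s = sqrt ((4 * t - 1) / 3)"
  define z where "z = (1 + s) / 2"
  have s2: "s\<^sup>2 = (4 * t - 1) / 3" and s: "0 < s" "s \<le> 1"
    using assms False by (auto simp: s_def)
  have z: "z \<in> {0<..1}" "\<lfloor>inverse z\<rfloor> = 1"
    using s by (auto simp: z_def field_simps intro!: floor_unique)
  have t: "t = (1 + 3 * s\<^sup>2) / 4"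
    using s2 by simp
  have "8 * cubic_profile z = t"
    unfolding cubic_profile_def z(2) t
    by (simp add: z_def field_simps power2_eq_square power3_eq_cube)
  moreover have "16 * quartic_profile z = 2 * (1 - t)\<^sup>2 / 9 + (4 * t - 1) / 3"
    unfolding quartic_profile_def z(2) t
    by (simp add: z_def field_simps power2_eq_square power4_eq_xxxx)
  ultimately show ?thesis
    using g_cubic_profile[OF z(1)] by (auto simp: scaled_g_def)
qed

lemma low_parameter_exists:
  fixes t :: real
  assumes "1/9 \<le> t" "t \<le> 1/4"
  obtains z where "1/3 \<le> z" "z \<le> 1/2" "t = 2 * z ^ 3 + (1 - 2 * z) ^ 3"
proof -
  have "\<exists>z\<ge>1/3. z \<le> 1/2 \<and> 2 * z ^ 3 + (1 - 2 * z) ^ 3 = t"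
    by (rule IVT') (use assms in \<open>auto intro!: continuous_intros simp: power3_eq_cube\<close>)
  then show ?thesis
    using that by blast
qed

text \<open>The condition on \<kappa> says that it is at most dG/dt along the parametrisation by z:
  the z-derivatives are 6 (3 z - 1) (1 - z) for the cubic sum and 8 (3 z - 1) (1 - 3 z + 3 z^2) for
  the quartic sum. Cancelling 3 z - 1 keeps it meaningful at z = 1/3.\<close>

lemma scaled_g_slope_low:
  fixes \<kappa> t t' :: real
  assumes t: "1/9 \<le> t" "t \<le> t'" "t' \<le> 1/4"
    and \<kappa>: "\<And>z. 1/3 \<le> z \<Longrightarrow> z \<le> 1/2 \<Longrightarrow> 2 * z ^ 3 + (1 - 2 * z) ^ 3 \<le> t' \<Longrightarrow>
      3 * \<kappa> * (1 - z) \<le> 4 * (1 - 3 * z + 3 * z\<^sup>2)"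
  shows "\<kappa> * (t' - t) \<le> scaled_g t' - scaled_g t"
proof -
  obtain z where z: "1/3 \<le> z" "z \<le> 1/2" "t = 2 * z ^ 3 + (1 - 2 * z) ^ 3"
    using t by (elim low_parameter_exists[rotated 2]) auto
  obtain w where w: "1/3 \<le> w" "w \<le> 1/2" "t' = 2 * w ^ 3 + (1 - 2 * w) ^ 3"
    using t by (elim low_parameter_exists[rotated 2]) auto
  have mono: "2 * x ^ 3 + (1 - 2 * x) ^ 3 < 2 * y ^ 3 + (1 - 2 * y) ^ 3"
    if "1/3 \<le> x" "x < y" "y \<le> 1/2" for x y :: real
    using cubic_piece_strict_mono[of 2 x y] that by simp
  have "z \<le> w"
    using mono[of w z] z w t by linarith
  define D where "D = (\<lambda>x::real. (2 * x ^ 4 + (1 - 2 * x) ^ 4) - \<kappa> * (2 * x ^ 3 + (1 - 2 * x) ^ 3))"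
  have "D z \<le> D w"
  proof (rule DERIV_nonneg_imp_nondecreasing[OF \<open>z \<le> w\<close>])
    fix x assume x: "z \<le> x" "x \<le> w"
    define d where "d = (3 * x - 1) * (2 * (4 * (1 - 3 * x + 3 * x\<^sup>2) - 3 * \<kappa> * (1 - x)))"
    have "(D has_real_derivative d) (at x)"
      unfolding D_def d_def
      by (auto intro!: derivative_eq_intros simp: algebra_simps power2_eq_square power3_eq_cube)
    moreover have "2 * x ^ 3 + (1 - 2 * x) ^ 3 \<le> t'"
      using mono[of x w] x z w by (cases "x = w") auto
    then have "0 \<le> d"
      using \<kappa>[of x] x z w unfolding d_def by (intro mult_nonneg_nonneg) auto
    ultimately show "\<exists>y. (D has_real_derivative y) (at x) \<and> 0 \<le> y"
      by blast
  qed
  then show ?thesis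
    using scaled_g_low[of z] scaled_g_low[of w] z w by (simp add: D_def algebra_simps)
qed

lemma scaled_g_slope_high:
  fixes \<kappa> t t' :: real
  assumes t: "1/4 \<le> t" "t \<le> t'" "t' \<le> 1" and "\<kappa> \<le> 1"
  shows "\<kappa> * (t' - t) \<le> scaled_g t' - scaled_g t"
proof -
  \<comment> \<open>The chord of the quadratic has slope 8/9 + 2/9 (t + t'), hence at least
    1.\<close>
  have "1/2 \<le> t + t'"
    using t by linarith
  then have "\<kappa> \<le> 8/9 + 2/9 * (t + t')"
    using \<open>\<kappa> \<le> 1\<close> by argo
  then have "\<kappa> * (t' - t) \<le> (8/9 + 2/9 * (t + t')) * (t' - t)"
    using t by (intro mult_right_mono) auto
  also have "\<dots> = scaled_g t' - scaled_g t"
    using scaled_g_high[of t] scaled_g_high[of t'] t by (simp add: field_simps power2_eq_square)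
  finally show ?thesis .
qed

lemma scaled_g_slope:
  fixes \<kappa> t t' :: real
  assumes t: "1/9 \<le> t" "t \<le> t'" "t' \<le> 1" and "\<kappa> \<le> 1"
    and \<kappa>: "\<And>z. 1/3 \<le> z \<Longrightarrow> z \<le> 1/2 \<Longrightarrow> 2 * z ^ 3 + (1 - 2 * z) ^ 3 \<le> t' \<Longrightarrow>
      3 * \<kappa> * (1 - z) \<le> 4 * (1 - 3 * z + 3 * z\<^sup>2)"
  shows "\<kappa> * (t' - t) \<le> scaled_g t' - scaled_g t"
proof -
  consider "t' \<le> 1/4" | "1/4 \<le> t" | "t < 1/4" "1/4 < t'"
    by linarith
  then show ?thesis
  proof cases
    case 1
    then show ?thesis
      using scaled_g_slope_low[of t t' \<kappa>] t \<kappa> by blast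
  next
    case 2
    then show ?thesis
      using scaled_g_slope_high assms by blast
  next
    case 3
    have "\<kappa> * (1/4 - t) \<le> scaled_g (1/4) - scaled_g t"
      using 3 t \<kappa> by (intro scaled_g_slope_low) auto
    moreover have "\<kappa> * (t' - 1/4) \<le> scaled_g t' - scaled_g (1/4)"
      using 3 assms by (intro scaled_g_slope_high) auto
    ultimately show ?thesis
      by (simp add: algebra_simps)
  qed
qed

lemma scaled_g_slope_ge_3_5:
  fixes t t' :: real
  assumes "1/9 \<le> t" "t \<le> t'" "t' \<le> 1"
  shows "3/5 * (t' - t) \<le> scaled_g t' - scaled_g t"
proof (rule scaled_g_slope[OF assms])
  fix z :: real
  have "0 \<le> 12 * (z - 17/40)\<^sup>2"
    by simp
  then show "3 * (3/5) * (1 - z) \<le> 4 * (1 - 3 * z + 3 * z\<^sup>2)"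
    unfolding power2_eq_square by argo
qed simp

subsection \<open>Real spectra\<close>

lemma quartic_ge_three:
  fixes a b c :: real
  assumes nn: "0 \<le> a" "0 \<le> b" "0 \<le> c" and sum: "a + b + c = 1"
    and t: "1/9 \<le> a ^ 3 + b ^ 3 + c ^ 3"
  shows "scaled_g (a ^ 3 + b ^ 3 + c ^ 3) \<le> a ^ 4 + b ^ 4 + c ^ 4"
proof -
  define t q where "t = a ^ 3 + b ^ 3 + c ^ 3" and "q = a * b + b * c + c * a"
  have c: "c = 1 - a - b"
    using sum by simp
  have p4: "a ^ 4 + b ^ 4 + c ^ 4 = 2 * q\<^sup>2 + (4 * t - 1) / 3"
    unfolding t_def q_def c by (simp add: field_simps power2_eq_square power3_eq_cube power4_eq_xxxx)
  have r: "3 * (a * b * c) = t - 1 + 3 * q"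
    unfolding t_def q_def c by (simp add: field_simps power2_eq_square power3_eq_cube)
  have r0: "0 \<le> a * b * c"
    using nn by simp
  show ?thesis
  proof (cases "1/4 \<le> t")
    case True
    have "a ^ 3 \<le> a" "b ^ 3 \<le> b" "c ^ 3 \<le> c"
      using nn sum power_le_one[of a 2] power_le_one[of b 2] power_le_one[of c 2]
      by (auto simp: power3_eq_cube power2_eq_square mult_left_le mult.assoc)
    then have t1: "t \<le> 1"
      using sum by (simp add: t_def)
    \<comment> \<open>Non-negativity of the product bounds q below, with equality when one of the
      numbers vanishes.\<close>
    have "(1 - t) / 3 \<le> q"
      using r r0 by simp
    then have "((1 - t) / 3)\<^sup>2 \<le> q\<^sup>2"
      using t1 by (intro power_mono) auto
    then show ?thesis
      using scaled_g_high[OF True t1] p4 unfolding t_def[symmetric] by (simp add: power_divide)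
  next
    case False
    then obtain z where z: "1/3 \<le> z" "z \<le> 1/2" "t = 2 * z ^ 3 + (1 - 2 * z) ^ 3"
      using t t_def by (elim low_parameter_exists[rotated 2]) auto
    define qz where "qz = 2 * z - 3 * z\<^sup>2"
    \<comment> \<open>\<open>t\<close> fixes all but one parameter of the cubic with roots \<open>a\<close>, \<open>b\<close>, \<open>c\<close>; it is compared with the
      cubic of the extremal triple \<open>z\<close>, \<open>z\<close>, \<open>1 - 2 z\<close>.\<close>
    have root: "(x - z)\<^sup>2 * (x - (1 - 2 * z)) = (q - qz) * (1 - x)" if "x = a \<or> x = b \<or> x = c" for x
    proof -
      have "(x - a) * (x - b) * (x - c) = 0"
        using that by auto
      moreover have "(x - a) * (x - b) * (x - c) = x ^ 3 - x\<^sup>2 + q * x - a * b * c"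
        unfolding q_def c by (simp add: algebra_simps power2_eq_square power3_eq_cube)
      ultimately have "x ^ 3 - x\<^sup>2 + q * x - (t - 1 + 3 * q) / 3 = 0"
        using r by simp
      then show ?thesis
        unfolding z(3) qz_def by (simp add: field_simps power2_eq_square power3_eq_cube)
    qed
    \<comment> \<open>A root x of at least 1/3 >= 1 - 2 z makes the left side of \<open>root\<close>
      non-negative, which gives the sign of \<open>q - qz\<close> once x = 1 is excluded.\<close>
    have "1/3 \<le> a \<or> 1/3 \<le> b \<or> 1/3 \<le> c"
      using sum by linarith
    then obtain x where x: "x = a \<or> x = b \<or> x = c" "1/3 \<le> x"
      by blast
    have "x \<le> 1"
      using x(1) nn sum by auto
    have "x \<noteq> 1"
    proof
      assume "x = 1"
      then have "a = 1 \<and> b = 0 \<and> c = 0 \<or> a = 0 \<and> b = 1 \<and> c = 0 \<or> a = 0 \<and> b = 0 \<and> c = 1"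
        using x(1) nn sum by linarith
      then have "t = 1"
        by (auto simp: t_def)
      then show False
        using False by simp
    qed
    moreover have "0 \<le> (x - z)\<^sup>2 * (x - (1 - 2 * z))"
      using x z by simp
    ultimately have "0 \<le> q - qz"
      using root[OF x(1)] \<open>x \<le> 1\<close> by (simp add: zero_le_mult_iff)
    moreover have "0 \<le> qz"
      using z mult_nonneg_nonneg[of z "2 - 3 * z"] by (simp add: qz_def power2_eq_square algebra_simps)
    ultimately have "qz\<^sup>2 \<le> q\<^sup>2"
      by (intro power_mono) auto
    moreover have "2 * z ^ 4 + (1 - 2 * z) ^ 4 = 2 * qz\<^sup>2 + (4 * t - 1) / 3"
      unfolding z(3) qz_def by (simp add: field_simps power2_eq_square power3_eq_cube power4_eq_xxxx)
    ultimately show ?thesis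
      using scaled_g_low[OF z(1,2)] p4 unfolding t_def[symmetric] z(3) by simp
  qed
qed

lemma sum_mset_real_nonneg:
  fixes f :: "'a \<Rightarrow> real"
  shows "(\<And>x. x \<in># M \<Longrightarrow> 0 \<le> f x) \<Longrightarrow> 0 \<le> (\<Sum>x\<in>#M. f x)"
  by (induction M) auto

lemma sum_mset_cube_le:
  fixes M :: "real multiset"
  shows "(\<And>x. x \<in># M \<Longrightarrow> 0 \<le> x) \<Longrightarrow> (\<Sum>x\<in>#M. x ^ 3) \<le> (\<Sum>x\<in>#M. x) ^ 3"
proof (induction M)
  case (add x M)
  define s where "s = (\<Sum>x\<in>#M. x)"
  have s: "0 \<le> s" "0 \<le> x"
    unfolding s_def using add.prems by (auto intro: sum_mset_real_nonneg[where f = "\<lambda>x. x", simplified])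
  have "(\<Sum>x\<in>#M. x ^ 3) \<le> s ^ 3"
    using add by (simp add: s_def)
  moreover have "0 \<le> 3 * (x * s) * (x + s)"
    using s by simp
  then have "x ^ 3 + s ^ 3 \<le> (x + s) ^ 3"
    by (simp add: power3_eq_cube algebra_simps)
  ultimately show ?case
    by (simp add: s_def)
qed simp

lemma quartic_ge_real:
  fixes M :: "real multiset"
  assumes "\<And>x. x \<in># M \<Longrightarrow> 0 \<le> x" and "(\<Sum>x\<in>#M. x) = 1" and "1/9 \<le> (\<Sum>x\<in>#M. x ^ 3)"
  shows "scaled_g (\<Sum>x\<in>#M. x ^ 3) \<le> (\<Sum>x\<in>#M. x ^ 4)"
proof -
  have "scaled_g (\<Sum>x\<in>#M. x ^ 3) \<le> (\<Sum>x\<in>#M. x ^ 4)"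
    if "size M = n + 3" "\<And>x. x \<in># M \<Longrightarrow> 0 \<le> x" "(\<Sum>x\<in>#M. x) = 1"
      "1/9 \<le> (\<Sum>x\<in>#M. x ^ 3)" for n and M :: "real multiset"
    using that
  proof (induction n arbitrary: M)
    case 0
    obtain xs where "mset xs = M"
      using ex_mset by blast
    moreover from this have "length xs = Suc (Suc (Suc 0))"
      using 0 by auto
    then obtain a b c where "xs = [a, b, c]"
      by (auto simp: length_Suc_conv)
    ultimately have "M = {#a, b, c#}"
      by auto
    then show ?case
      using quartic_ge_three[of a b c] 0 by (auto simp: algebra_simps)
  next
    case (Suc n)
    define xs where "xs = sorted_list_of_multiset M"
    have xs: "mset xs = M" "sorted xs"
      by (simp_all add: xs_def)
    have "length xs = Suc n + 3"
      using Suc.prems(1) xs(1) by (metis size_mset)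
    then obtain u v p q ys where l: "xs = u # v # p # q # ys"
      by (auto simp: eval_nat_numeral length_Suc_conv)
    define R where "R = mset (p # q # ys)"
    have M: "M = {#u, v#} + R"
      unfolding xs(1)[symmetric] l R_def by (simp add: add_mset_commute)
    have uv: "0 \<le> u" "u \<le> v" "v \<le> p" "v \<le> q"
      using xs l Suc.prems(2)[of u] M by auto
    have "0 \<le> (\<Sum>x\<in># mset ys. x)"
      using Suc.prems(2) M by (intro sum_mset_real_nonneg) (auto simp: R_def)
    \<comment> \<open>Uses two further elements of size at least v; this is why merging stops at
      three numbers.\<close>
    then have le1: "u + 3 * v \<le> 1"
      using Suc.prems(3) uv by (simp add: M R_def)
    define N where "N = add_mset (u + v) R"
    define t t' where "t = (\<Sum>x\<in>#M. x ^ 3)" and "t' = (\<Sum>x\<in>#N. x ^ 3)"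
    have N0: "0 \<le> x" if "x \<in># N" for x
      using Suc.prems(2)[of x] uv that by (auto simp: N_def M)
    have N1: "(\<Sum>x\<in>#N. x) = 1"
      using Suc.prems(3) by (simp add: N_def M)
    have d: "t' - t = 3 * u * v * (u + v)"
      by (simp add: t_def t'_def M N_def power3_eq_cube algebra_simps)
    have tt: "t \<le> t'"
      using d uv by (smt (verit) mult_nonneg_nonneg)
    have t1: "1/9 \<le> t" "t' \<le> 1"
      using Suc.prems(4) sum_mset_cube_le[of N] N0 N1 by (auto simp: t_def t'_def)
    have IH: "scaled_g t' \<le> (\<Sum>x\<in>#N. x ^ 4)"
      unfolding t'_def using Suc.prems(1) N0 N1 tt t1
      by (intro Suc.IH) (auto simp: N_def M t'_def)
    have slope: "3/5 * (t' - t) \<le> scaled_g t' - scaled_g t"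
      by (rule scaled_g_slope_ge_3_5[OF t1(1) tt t1(2)])
    \<comment> \<open>Merging raises the quartic sum by u v times the left side and the cubic sum by
      3 u v (u + v); 9/5 is 3 * 3/5. The factor u + 3 v <= 1 makes the inequality
      homogeneous.\<close>
    have "4 * u\<^sup>2 + 6 * u * v + 4 * v\<^sup>2 \<le> 9/5 * (u + v) * (u + 3 * v)"
    proof -
      have "0 \<le> (v - u) * (11 * u + 7 * v) + 2 * (u * v)"
        using uv by (intro add_nonneg_nonneg mult_nonneg_nonneg) auto
      then show ?thesis
        by (simp add: power2_eq_square algebra_simps)
    qed
    also have "\<dots> \<le> 9/5 * (u + v)"
      using uv le1 by (intro mult_left_le) auto
    finally have "u * v * (4 * u\<^sup>2 + 6 * u * v + 4 * v\<^sup>2) \<le> u * v * (9/5 * (u + v))"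
      using uv by (intro mult_left_mono) auto
    also have "u * v * (4 * u\<^sup>2 + 6 * u * v + 4 * v\<^sup>2) = (\<Sum>x\<in>#N. x ^ 4) - (\<Sum>x\<in>#M. x ^ 4)"
      by (simp add: M N_def power2_eq_square power4_eq_xxxx algebra_simps)
    also have "u * v * (9/5 * (u + v)) = 3/5 * (t' - t)"
      unfolding d by simp
    finally show ?case
      using IH slope unfolding t_def[symmetric] by linarith
  qed
  \<comment> \<open>Padding with zeros ensures at least three elements and leaves the power sums
    unchanged.\<close>
  from this[of "M + {#0, 0, 0#}" "size M"] show ?thesis
    using assms by auto
qed

subsection \<open>The Perron eigenvalue\<close>

text \<open>Unless c = 1, the geometric sums stay bounded by 2 / |c - 1|.\<close>

lemma cesaro_power_tendsto:
  fixes c :: complex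
  assumes "cmod c \<le> 1"
  shows "(\<lambda>N. (\<Sum>k<N. c ^ k) / of_nat N) \<longlonglongrightarrow> (if c = 1 then 1 else 0)"
proof (cases "c = 1")
  case True
  have "\<forall>\<^sub>F N in sequentially. 1 = (\<Sum>k<N. c ^ k) / of_nat N"
    using eventually_gt_at_top[of 0] by eventually_elim (simp add: True)
  then show ?thesis
    using True by (auto intro: Lim_transform_eventually[OF tendsto_const])
next
  case False
  have "norm ((\<Sum>k<N. c ^ k) / of_nat N) \<le> (2 / cmod (c - 1)) / of_nat N" for N
  proof -
    have "cmod (c ^ N) \<le> 1"
      using assms by (simp add: norm_power power_le_one)
    then have "cmod (c ^ N - 1) \<le> 2"
      using norm_triangle_ineq4[of "c ^ N" 1] by simp
    then show ?thesis
      using False by (simp add: geometric_sum norm_divide norm_mult divide_right_mono)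
  qed
  then have "(\<lambda>N. (\<Sum>k<N. c ^ k) / of_nat N) \<longlonglongrightarrow> 0"
    by (intro tendsto_0_le[OF lim_const_over_n[of "2 / cmod (c - 1)"], where K = 1] always_eventually)
      (simp add: norm_divide norm_mult)
  then show ?thesis
    using False by simp
qed

lemma cesaro_power_sums_tendsto:
  fixes M :: "complex multiset" and w :: complex
  assumes "\<And>e. e \<in># M \<Longrightarrow> cmod (e * w) \<le> 1"
  shows "(\<lambda>N. (\<Sum>k<N. (\<Sum>e\<in>#M. e ^ k) * w ^ k) / of_nat N) \<longlonglongrightarrow>
    of_nat (size {#e \<in># M. e * w = 1#})"
  using assms
proof (induction M)
  case (add x M)
  have "(\<lambda>N. (\<Sum>k<N. (x * w) ^ k) / of_nat N + (\<Sum>k<N. (\<Sum>e\<in>#M. e ^ k) * w ^ k) / of_nat N) \<longlonglongrightarrow>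
    (if x * w = 1 then 1 else 0) + of_nat (size {#e \<in># M. e * w = 1#})"
    using add by (intro tendsto_add cesaro_power_tendsto) auto
  then show ?case
    by (auto simp: distrib_right sum.distrib add_divide_distrib power_mult_distrib split: if_splits)
qed simp

text \<open>The Cesaro means of \<open>p k * w ^ k\<close>, where \<open>p k\<close> is the \<open>k\<close>-th power sum, count the elements
  equal to \<open>1 / w\<close>. As \<open>p k \<ge> 0\<close>, they are dominated by the means for \<open>cmod w\<close>.\<close>

lemma nonneg_power_sums_dominant:
  fixes M :: "complex multiset" and p :: "nat \<Rightarrow> real"
  assumes p: "\<And>k. (\<Sum>e\<in>#M. e ^ k) = of_real (p k)" "\<And>k. 0 \<le> p k" and M: "M \<noteq> {#}"
  obtains r where "0 \<le> r" "complex_of_real r \<in># M" "\<And>e. e \<in># M \<Longrightarrow> cmod e \<le> r"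
proof -
  define r where "r = Max (cmod ` set_mset M)"
  have r_max: "cmod e \<le> r" if "e \<in># M" for e
    using that by (simp add: r_def)
  have "r \<in> cmod ` set_mset M"
    unfolding r_def using M by (intro Max_in) auto
  then obtain e0 where e0: "e0 \<in># M" "cmod e0 = r"
    by auto
  have "0 \<le> r"
    using e0(2) norm_ge_zero[of e0] by simp
  moreover have "complex_of_real r \<in># M"
  proof (cases "r = 0")
    case True
    then show ?thesis
      using e0 by simp
  next
    case False
    then have r: "0 < r"
      using \<open>0 \<le> r\<close> by simp
    \<comment> \<open>With this w the element \<open>e0\<close> is counted, so the limit at w is
      positive; domination makes the limit at 1 / r positive too, and that one counts r.\<close>
    define w where "w = 1 / e0"
    define C where "C = (\<lambda>w N. (\<Sum>k<N. (\<Sum>e\<in>#M. e ^ k) * w ^ k) / of_nat N :: complex)"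
    have lim: "C v \<longlonglongrightarrow> of_nat (size {#e \<in># M. e * v = 1#})" if "cmod v = 1 / r" for v
      unfolding C_def
    proof (rule cesaro_power_sums_tendsto)
      fix e assume "e \<in># M"
      then show "cmod (e * v) \<le> 1"
        using r r_max[of e] that by (simp add: norm_mult)
    qed
    have w: "cmod w = 1 / r"
      using e0 by (simp add: w_def norm_divide)
    have "norm (C w N) \<le> norm (C (of_real (1 / r)) N)" for N
    proof -
      have "norm (\<Sum>k<N. of_real (p k) * w ^ k) \<le> (\<Sum>k<N. p k * (1 / r) ^ k)"
        using p(2) by (intro sum_norm_le) (simp add: norm_mult norm_power w)
      also have "\<dots> = norm (complex_of_real (\<Sum>k<N. p k * (1 / r) ^ k))"
        unfolding norm_of_real using p(2) r by (simp add: sum_nonneg)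
      finally show ?thesis
        unfolding C_def p(1) by (simp add: norm_divide divide_right_mono)
    qed
    then have "norm (of_nat (size {#e \<in># M. e * w = 1#}) :: complex) \<le>
        norm (of_nat (size {#e \<in># M. e * complex_of_real (1 / r) = 1#}) :: complex)"
      using r by (intro LIMSEQ_le[OF tendsto_norm[OF lim[OF w]] tendsto_norm[OF lim]]) (auto simp: norm_divide)
    moreover have "e0 \<in># {#e \<in># M. e * w = 1#}"
      using e0 r by (auto simp: w_def)
    then have "0 < size {#e \<in># M. e * w = 1#}"
      by (metis nonempty_has_size empty_iff set_mset_empty)
    ultimately have "0 < size {#e \<in># M. e * complex_of_real (1 / r) = 1#}"
      by simp
    then obtain e where e: "e \<in># M" "e * complex_of_real (1 / r) = 1"
      by (metis (mono_tags, lifting) nonempty_has_size multiset_nonemptyE filter_mset_eq_conv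
          mem_Collect_eq set_mset_filter)
    then have "e = complex_of_real r"
      using r by (simp add: field_simps)
    then show ?thesis
      using e by simp
  qed
  ultimately show ?thesis
    using r_max that by blast
qed

subsection \<open>Complex spectra\<close>

lemma Re_cube: "Re (e ^ 3) = Re e ^ 3 - 3 * Re e * (Im e)\<^sup>2"
  by (simp add: power3_eq_cube power2_eq_square algebra_simps)

lemma Re_power4: "Re (e ^ 4) = Re e ^ 4 - 6 * (Re e)\<^sup>2 * (Im e)\<^sup>2 + Im e ^ 4"
  by (simp add: power4_eq_xxxx power2_eq_square algebra_simps)

text \<open>For e = a + i b the two sides differ by b^2 (b^2 + 3 a (\<kappa> - 2 a)).\<close>

lemma quartic_minus_cubic_Re:
  fixes e :: complex and \<kappa> :: real
  assumes "0 \<le> Re e" and "Im e \<noteq> 0 \<Longrightarrow> 2 * Re e \<le> \<kappa>"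
  shows "Re e ^ 4 - \<kappa> * Re e ^ 3 \<le> Re (e ^ 4) - \<kappa> * Re (e ^ 3)"
proof -
  have "0 \<le> (Im e)\<^sup>2 * ((Im e)\<^sup>2 + 3 * Re e * (\<kappa> - 2 * Re e))"
    using assms by (cases "Im e = 0") auto
  then show ?thesis
    unfolding Re_cube Re_power4 by (simp add: power2_eq_square power3_eq_cube power4_eq_xxxx algebra_simps)
qed

text \<open>Allows \<kappa> = 2 a in \<open>scaled_g_slope\<close>. With a = 1/3 - d and z = 1/3 + e
  the cubic sums are 1/9 + 6 d^2 (1 + d) and 1/9 + 6 e^2 (1 - e), so e is at most a small multiple
  of d; the claim then follows from terms linear in d.\<close>

lemma slope_condition_pair:
  fixes a z :: real
  assumes a: "3/10 < a" "a \<le> 1/3" and z: "1/3 \<le> z" "z \<le> 1/2"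
    and le: "2 * z ^ 3 + (1 - 2 * z) ^ 3 \<le> 2 * a ^ 3 + (1 - 2 * a) ^ 3"
  shows "3 * (2 * a) * (1 - z) \<le> 4 * (1 - 3 * z + 3 * z\<^sup>2)"
proof -
  define d e where "d = 1/3 - a" and "e = z - 1/3"
  have de: "0 \<le> d" "d < 1/30" "0 \<le> e" "e \<le> 1/6" "a = 1/3 - d" "z = 1/3 + e"
    using a z by (auto simp: d_def e_def)
  have le': "e\<^sup>2 * (1 - e) \<le> d\<^sup>2 * (1 + d)"
    using le unfolding de(5,6) by (simp add: power2_eq_square power3_eq_cube field_simps)
  have "e \<le> 3/2 * d"
  proof (rule ccontr)
    assume "\<not> e \<le> 3/2 * d"
    then have lt: "3/2 * d < e"
      by simp
    have "(3/2 * d)\<^sup>2 < e\<^sup>2"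
      using lt de by (intro power_strict_mono) auto
    moreover have "e\<^sup>2 * (5/6) \<le> e\<^sup>2 * (1 - e)"
      using de by (intro mult_left_mono) auto
    moreover have "d\<^sup>2 * (1 + d) \<le> d\<^sup>2 * (31/30)"
      using de by (intro mult_left_mono) auto
    ultimately show False
      using le' zero_le_power2[of d] by (simp add: power_mult_distrib power_divide)
  qed
  moreover have "6 * d * e \<le> d"
    using de mult_left_mono[of "6 * e" 1 d] by simp
  moreover have "0 \<le> e\<^sup>2"
    by simp
  ultimately have "0 \<le> - 2 * e + 12 * e\<^sup>2 + 4 * d - 6 * d * e"
    by linarith
  then show ?thesis
    unfolding de(5,6) by (simp add: power2_eq_square field_simps)
qed

lemma quartic_ge_complex:
  fixes M :: "complex multiset" and r :: real
  assumes Re: "\<And>e. e \<in># M \<Longrightarrow> 0 \<le> Re e"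
    and cnj: "\<And>e. e \<in># M \<Longrightarrow> cnj e \<in># M"
    and dom: "complex_of_real r \<in># M" "\<And>e. e \<in># M \<Longrightarrow> Re e \<le> r"
    and sum: "(\<Sum>e\<in>#M. Re e) = 1"
    and t: "1/9 \<le> (\<Sum>e\<in>#M. Re (e ^ 3))"
  shows "scaled_g (\<Sum>e\<in>#M. Re (e ^ 3)) \<le> (\<Sum>e\<in>#M. Re (e ^ 4))"
proof -
  define t s where "t = (\<Sum>e\<in>#M. Re (e ^ 3))" and "s = (\<Sum>e\<in>#M. Re e ^ 3)"
  define X where "X = image_mset Re M"
  have X: "x \<in># X \<Longrightarrow> 0 \<le> x" "(\<Sum>x\<in>#X. x) = 1" "(\<Sum>x\<in>#X. x ^ 3) = s"
      "(\<Sum>x\<in>#X. x ^ 4) = (\<Sum>e\<in>#M. Re e ^ 4)" for x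
    using Re sum by (auto simp: X_def s_def multiset.map_comp comp_def)
  have ts: "t \<le> s"
    unfolding t_def s_def using Re by (intro sum_mset_mono) (simp add: Re_cube)
  have s1: "s \<le> 1"
    using sum_mset_cube_le[of X] X by simp
  have real: "scaled_g s \<le> (\<Sum>e\<in>#M. Re e ^ 4)"
    using quartic_ge_real[of X] X t ts by (simp add: t_def)
  \<comment> \<open>Two competing demands: \<kappa> must be large enough for
    \<open>quartic_minus_cubic_Re\<close> and small enough to bound the slope of G between t and s
    from below.\<close>
  obtain \<kappa> where \<kappa>: "\<And>e. e \<in># M \<Longrightarrow> Im e \<noteq> 0 \<Longrightarrow> 2 * Re e \<le> \<kappa>"
      "\<kappa> * (s - t) \<le> scaled_g s - scaled_g t"
  proof (cases "\<forall>e\<in>#M. Im e \<noteq> 0 \<longrightarrow> Re e \<le> 3/10")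
    case True
    then show ?thesis
      using that[of "3/5"] scaled_g_slope_ge_3_5[of t s] t ts s1 by (fastforce simp: t_def)
  next
    case False
    define Z where "Z = {e \<in> set_mset M. Im e \<noteq> 0}"
    have Z: "finite Z" "Z \<noteq> {}"
      using False by (auto simp: Z_def)
    define a where "a = Max (Re ` Z)"
    have a_max: "Re e \<le> a" if "e \<in> Z" for e
      using that Z by (simp add: a_def)
    have "a \<in> Re ` Z"
      unfolding a_def using Z by (intro Max_in) auto
    then obtain e where e: "e \<in># M" "Im e \<noteq> 0" "Re e = a"
      by (auto simp: Z_def)
    have a: "3/10 < a"
      using False a_max by (force simp: Z_def)
    \<comment> \<open>Closure under conjugation is known only for membership; distinctness lets both
      elements be split off from the multiset.\<close>
    have "e \<noteq> cnj e"
      using e by (auto simp: complex_eq_iff)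
    then have "{#e, cnj e#} \<subseteq># M"
      using e cnj by (simp add: insert_subset_eq_iff in_diff_count)
    then obtain R where M: "M = {#e, cnj e#} + R"
      by (metis subset_mset.add_diff_inverse)
    have "r \<le> (\<Sum>e\<in>#R. Re e)"
    proof -
      have "complex_of_real r \<noteq> e" "complex_of_real r \<noteq> cnj e"
        using e(2) by (auto simp: complex_eq_iff)
      then have "complex_of_real r \<in># R"
        using dom(1) unfolding M by simp
      then obtain R' where R': "R = add_mset (complex_of_real r) R'"
        by (metis mset_add)
      have "0 \<le> (\<Sum>e\<in>#R'. Re e)"
        using Re by (intro sum_mset_real_nonneg) (auto simp: M R')
      then show ?thesis
        by (simp add: R')
    qed
    moreover have R1: "(\<Sum>e\<in>#R. Re e) = 1 - 2 * a"
      using sum e by (simp add: M)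
    ultimately have a3: "a \<le> 1/3"
      using dom(2)[OF e(1)] e by simp
    \<comment> \<open>Bounding the remaining cubes by the cube of their sum 1 - 2 a confines s to
      the range of \<open>slope_condition_pair\<close>.\<close>
    have "(\<Sum>x\<in>#image_mset Re R. x ^ 3) \<le> (\<Sum>x\<in>#image_mset Re R. x) ^ 3"
      using Re by (intro sum_mset_cube_le) (auto simp: M)
    then have s_le: "s \<le> 2 * a ^ 3 + (1 - 2 * a) ^ 3"
      using R1 e by (simp add: s_def M multiset.map_comp comp_def)
    have "2 * a * (s - t) \<le> scaled_g s - scaled_g t"
      using t ts s1 a a3 s_le
      by (intro scaled_g_slope slope_condition_pair) (auto simp: t_def)
    then show ?thesis
      using that[of "2 * a"] a a_max by (auto simp: Z_def)
  qed
  have "(\<Sum>e\<in>#M. Re e ^ 4 - \<kappa> * Re e ^ 3) \<le> (\<Sum>e\<in>#M. Re (e ^ 4) - \<kappa> * Re (e ^ 3))"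
    using Re \<kappa>(1) by (intro sum_mset_mono quartic_minus_cubic_Re)
  moreover have "(\<Sum>e\<in>#M. f e - \<kappa> * h e) = (\<Sum>e\<in>#M. f e) - \<kappa> * (\<Sum>e\<in>#M. h e)"
    for f h :: "complex \<Rightarrow> real"
    by (induction M) (auto simp: algebra_simps)
  ultimately have "(\<Sum>e\<in>#M. Re e ^ 4) - \<kappa> * s \<le> (\<Sum>e\<in>#M. Re (e ^ 4)) - \<kappa> * t"
    unfolding s_def t_def by metis
  then show ?thesis
    using real \<kappa>(2) unfolding t_def[symmetric] by (simp add: algebra_simps)
qed

subsection \<open>Tournament matrices\<close>

text \<open>For an eigenvector x, the form x^* A x equals \<mu> |x|^2; adding its conjugate replaces
  A by the all-ones matrix and leaves the square of |sum of x|.\<close>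

lemma tournament_eigenvalue_Re_nonneg:
  assumes A: "tournament_matrix n A" and ev: "eigenvalue (map_mat complex_of_real A) \<mu>"
  shows "0 \<le> Re \<mu>"
proof -
  have carr: "A \<in> carrier_mat n n" and sum1: "A + transpose_mat A = mat n n (\<lambda>_. 1)"
    using A by (auto simp: tournament_matrix_def)
  have entry: "A $$ (i, j) + A $$ (j, i) = 1" if "i < n" "j < n" for i j
    using arg_cong[OF sum1, of "\<lambda>B. B $$ (i, j)"] carr that by simp
  obtain v where v: "v \<in> carrier_vec n" "v \<noteq> 0\<^sub>v n" "map_mat complex_of_real A *\<^sub>v v = \<mu> \<cdot>\<^sub>v v"
    using ev carr by (auto simp: eigenvalue_def eigenvector_def)
  define x where "x = (\<lambda>i. v $ i)"
  have eq: "(\<Sum>j<n. complex_of_real (A $$ (i, j)) * x j) = \<mu> * x i" if "i < n" for i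
    using arg_cong[OF v(3), of "\<lambda>u. u $ i"] v(1) carr that
    by (simp add: x_def scalar_prod_def lessThan_atLeast0)
  define N where "N = (\<Sum>i<n. (cmod (x i))\<^sup>2)"
  define S where "S = (\<Sum>i<n. \<Sum>j<n. complex_of_real (A $$ (i, j)) * (cnj (x i) * x j))"
  obtain i where "i < n" "x i \<noteq> 0"
    using v(1,2) unfolding x_def by (metis eq_vecI carrier_vecD index_zero_vec)
  then have N: "0 < N"
    unfolding N_def by (intro sum_pos2[of _ i]) auto
  have "S = (\<Sum>i<n. cnj (x i) * (\<mu> * x i))"
    unfolding S_def by (simp add: eq[symmetric] sum_distrib_left mult_ac)
  also have "\<dots> = \<mu> * (\<Sum>i<n. complex_of_real ((cmod (x i))\<^sup>2))"
    unfolding complex_norm_square by (simp add: sum_distrib_left mult_ac)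
  also have "\<dots> = \<mu> * of_real N"
    by (simp add: N_def)
  finally have S: "S = \<mu> * of_real N" .
  have "cnj S = (\<Sum>i<n. \<Sum>j<n. complex_of_real (A $$ (j, i)) * (cnj (x i) * x j))"
    unfolding S_def cnj_sum by (subst sum.swap) (simp add: mult_ac)
  then have "S + cnj S = (\<Sum>i<n. \<Sum>j<n. complex_of_real (A $$ (i, j) + A $$ (j, i)) * (cnj (x i) * x j))"
    by (simp add: S_def sum.distrib distrib_right)
  also have "\<dots> = (\<Sum>i<n. \<Sum>j<n. cnj (x i) * x j)"
    by (intro sum.cong refl) (simp add: entry)
  also have "\<dots> = cnj (\<Sum>i<n. x i) * (\<Sum>i<n. x i)"
    by (simp add: sum_product)
  finally have "2 * Re S = (cmod (\<Sum>i<n. x i))\<^sup>2"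
    unfolding complex_add_cnj by (metis Re_complex_of_real complex_norm_square mult.commute)
  then have "0 \<le> Re S"
    by (smt (verit) zero_le_power2)
  then show ?thesis
    using N by (simp add: S zero_le_mult_iff)
qed

lemma eigenvalue_real_cnj:
  fixes A :: "real mat"
  assumes "A \<in> carrier_mat n n" and "eigenvalue (map_mat complex_of_real A) \<mu>"
  shows "eigenvalue (map_mat complex_of_real A) (cnj \<mu>)"
proof -
  have c: "map_mat complex_of_real A \<in> carrier_mat n n"
    using assms by simp
  have "poly (map_poly complex_of_real (char_poly A)) (cnj \<mu>) =
      cnj (poly (map_poly complex_of_real (char_poly A)) \<mu>)"
    by (intro poly_cnj_real[symmetric]) (simp add: coeff_map_poly)
  then show ?thesis
    using assms(2) unfolding eigenvalue_root_char_poly[OF c] of_real_hom.char_poly_hom[OF assms(1)]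
    by simp
qed

text \<open>Here the entrywise non-negativity of A enters; it supplies the non-negative power sums
  for \<open>nonneg_power_sums_dominant\<close>.\<close>

lemma mat_trace_power_nonneg:
  assumes "tournament_matrix n A"
  shows "0 \<le> mat_trace (A ^\<^sub>m k)"
proof -
  have A: "A \<in> carrier_mat n n" "\<And>i j. i < n \<Longrightarrow> j < n \<Longrightarrow> 0 \<le> A $$ (i, j)"
    using assms by (auto simp: tournament_matrix_def)
  have "\<forall>i<n. \<forall>j<n. 0 \<le> (A ^\<^sub>m k) $$ (i, j)"
  proof (induction k)
    case 0
    then show ?case using A by simp
  next
    case (Suc k)
    have "A ^\<^sub>m k \<in> carrier_mat n n"
      using A by simp
    then show ?case
      using A Suc by (auto simp: scalar_prod_def intro!: sum_nonneg)
  qed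
  then show ?thesis
    using A by (auto simp: mat_trace_def intro!: sum_nonneg)
qed

theorem theorem11:
  fixes n :: nat and A :: "real mat"
  assumes "tournament_matrix n A"
    and "sigma 3 A \<ge> 1/72"
  shows "sigma 4 A \<ge> g (sigma 3 A)"
proof -
  have A: "A \<in> carrier_mat n n" and sum1: "A + transpose_mat A = mat n n (\<lambda>_. 1)"
    using assms(1) by (auto simp: tournament_matrix_def)
  let ?B = "map_mat complex_of_real A"
  have B: "?B \<in> carrier_mat n n"
    using A by simp
  \<comment> \<open>For n = 0 the quotient defining \<open>sigma 3 A\<close> is 0 / 0 = 0, below
    1/72.\<close>
  have n: "0 < n"
    using assms(2) A by (intro gr0I) (simp add: sigma_def)
  have diag: "A $$ (i, i) = 1/2" if "i < n" for i
    using arg_cong[OF sum1, of "\<lambda>B. B $$ (i, i)"] A that by simp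
  \<comment> \<open>The trace of A is n / 2, so the factor 2 / n makes the elements sum to 1 and
    turns the bound 1/72 into 1/9.\<close>
  define M where "M = image_mset (\<lambda>e. 2 / of_nat n * e) (proots (char_poly ?B))"
  have ev: "e \<in># M \<longleftrightarrow> (\<exists>\<mu>. eigenvalue ?B \<mu> \<and> e = 2 / of_nat n * \<mu>)" for e
  proof -
    have "char_poly ?B \<noteq> 0"
      using degree_monic_char_poly[OF B] by auto
    then have "\<mu> \<in># proots (char_poly ?B) \<longleftrightarrow> eigenvalue ?B \<mu>" for \<mu>
      by (simp add: eigenvalue_root_char_poly[OF B])
    then show ?thesis
      by (auto simp: M_def)
  qed
  have pow: "(\<Sum>e\<in>#M. e ^ l) = of_real (2 ^ l * sigma l A)" for l
  proof -
    have "(\<Sum>x\<in>#N. (2 / of_nat n * x) ^ l) = 2 ^ l * ((\<Sum>x\<in>#N. x ^ l) / of_nat n ^ l)"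
      for N :: "complex multiset"
      by (induction N) (auto simp: power_mult_distrib power_divide add_divide_distrib distrib_left)
    then show ?thesis
      unfolding of_real_mult sigma_eigenvalues[OF A] M_def multiset.map_comp comp_def by simp
  qed
  have Re_pow: "(\<Sum>e\<in>#M. Re (e ^ l)) = 2 ^ l * sigma l A" for l
  proof -
    have "(\<Sum>e\<in>#M. Re (e ^ l)) = Re (\<Sum>e\<in>#M. e ^ l)"
      by (induction M) auto
    then show ?thesis
      by (simp add: pow)
  qed
  have sigma1: "sigma 1 A = 1/2"
    using A n by (simp add: sigma_def mat_trace_def diag)
  have "M \<noteq> {#}"
    using Re_pow[of 1] sigma1 by auto
  moreover have "0 \<le> 2 ^ l * sigma l A" for l
    using mat_trace_power_nonneg[OF assms(1), of l] by (simp add: sigma_def)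
  ultimately obtain r where r: "complex_of_real r \<in># M" "\<And>e. e \<in># M \<Longrightarrow> cmod e \<le> r"
    using nonneg_power_sums_dominant[OF pow] by metis
  have "scaled_g (\<Sum>e\<in>#M. Re (e ^ 3)) \<le> (\<Sum>e\<in>#M. Re (e ^ 4))"
  proof (rule quartic_ge_complex)
    fix e assume e: "e \<in># M"
    show "0 \<le> Re e"
      using e tournament_eigenvalue_Re_nonneg[OF assms(1)] by (auto simp: ev)
    show "cnj e \<in># M"
      using e eigenvalue_real_cnj[OF A] unfolding ev by fastforce
    show "Re e \<le> r"
      using r(2)[OF e] complex_Re_le_cmod[of e] by linarith
  next
    show "(\<Sum>e\<in>#M. Re e) = 1"
      using Re_pow[of 1] sigma1 by simp
    show "1/9 \<le> (\<Sum>e\<in>#M. Re (e ^ 3))"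
      using assms(2) by (simp add: Re_pow)
  qed (rule r(1))
  then show ?thesis
    by (simp add: Re_pow scaled_g_def)
qed

end
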